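(* Let $\mathfrak{so}(2)$ be the Lie algebra of $\mathrm{SO}(2)\simeq S^1$. The de Rham cohomology spaces of $\mathrm{SO}(2)$, computed on left-invariant forms, are $$\mathrm{H}^0(\mathfrak{so}(2),\mathbb{R})\simeq\mathbb{R},\qquad \mathrm{H}^1(\mathfrak{so}(2),\mathbb{R})\simeq\mathbb{R}.$$
   Context: $\mathrm{H}^k(\mathfrak{g},\mathbb{R})$ denotes the cohomology of the complex of left-invariant differential forms on the Lie group (equivalently of alternating forms on the Lie algebra $\mathfrak{g}$) with the exterior differential, so that $\mathrm{d}\omega(X,Y)=-\omega([X,Y])$ for a left-invariant one-form $\omega$ and left-invariant vector fields $X,Y$. *)

theory Defs
  imports "HOL-Analysis.Analysis" "HOL-Library.Function_Algebras"
begin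

section \<open>Real vector spaces of functions, quotients, isomorphism\<close>

instantiation "fun" :: (type, real_vector) real_vector
begin

definition scaleR_fun_def: "c *\<^sub>R f = (\<lambda>x. c *\<^sub>R f x)"

instance
  by standard (auto simp: scaleR_fun_def fun_eq_iff algebra_simps)

end

text \<open>
  Isabelle has no quotient of a subspace by a subspace as a type, so a real vector space
  is represented here by its carrier together with its two operations.
\<close>

record 'v rvspace =
  vcarrier :: "'v set"
  vadd :: "'v \<Rightarrow> 'v \<Rightarrow> 'v"
  vscale :: "real \<Rightarrow> 'v \<Rightarrow> 'v"

definition real_line :: "real rvspace" where
  "real_line = \<lparr>vcarrier = UNIV, vadd = (+), vscale = (*)\<rparr>"

definition quot_rel :: "'v::real_vector set \<Rightarrow> 'v set \<Rightarrow> ('v \<times> 'v) set" where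
  "quot_rel V W = {(u, v). u \<in> V \<and> v \<in> V \<and> u - v \<in> W}"

definition quotient_rvspace :: "'v::real_vector set \<Rightarrow> 'v set \<Rightarrow> 'v set rvspace" where
  "quotient_rvspace V W = \<lparr>
     vcarrier = V // quot_rel V W,
     vadd = (\<lambda>A B. \<Union>a\<in>A. \<Union>b\<in>B. quot_rel V W `` {a + b}),
     vscale = (\<lambda>c A. \<Union>a\<in>A. quot_rel V W `` {c *\<^sub>R a})\<rparr>"

definition rvspace_iso :: "'u rvspace \<Rightarrow> 'v rvspace \<Rightarrow> bool" (infix "\<simeq>" 50) where
  "M \<simeq> N \<longleftrightarrow> (\<exists>f. bij_betw f (vcarrier M) (vcarrier N)
     \<and> (\<forall>x\<in>vcarrier M. \<forall>y\<in>vcarrier M. f (vadd M x y) = vadd N (f x) (f y))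
     \<and> (\<forall>c. \<forall>x\<in>vcarrier M. f (vscale M c x) = vscale N c (f x)))"


section \<open>Cohomology of a real Lie algebra with trivial coefficients\<close>

locale lie_algebra =
  fixes \<gg> :: "'a::real_vector set" and br :: "'a \<Rightarrow> 'a \<Rightarrow> 'a"
  assumes carrier_subspace: "subspace \<gg>"
    and br_closed: "\<lbrakk>x \<in> \<gg>; y \<in> \<gg>\<rbrakk> \<Longrightarrow> br x y \<in> \<gg>"
    and br_add_left: "\<lbrakk>x \<in> \<gg>; y \<in> \<gg>; z \<in> \<gg>\<rbrakk> \<Longrightarrow> br (x + y) z = br x z + br y z"
    and br_scale_left: "\<lbrakk>x \<in> \<gg>; y \<in> \<gg>\<rbrakk> \<Longrightarrow> br (c *\<^sub>R x) y = c *\<^sub>R br x y"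
    and br_add_right: "\<lbrakk>x \<in> \<gg>; y \<in> \<gg>; z \<in> \<gg>\<rbrakk> \<Longrightarrow> br x (y + z) = br x y + br x z"
    and br_scale_right: "\<lbrakk>x \<in> \<gg>; y \<in> \<gg>\<rbrakk> \<Longrightarrow> br x (c *\<^sub>R y) = c *\<^sub>R br x y"
    and br_self: "x \<in> \<gg> \<Longrightarrow> br x x = 0"
    and jacobi: "\<lbrakk>x \<in> \<gg>; y \<in> \<gg>; z \<in> \<gg>\<rbrakk> \<Longrightarrow>
       br x (br y z) + br y (br z x) + br z (br x y) = 0"

text \<open>
  A \<open>k\<close>-form takes the list of its \<open>k\<close> arguments. Forms vanish outside \<open>klists \<gg> k\<close>,
  so that two forms are equal as functions iff they agree on \<open>\<gg>\<close>.
\<close>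

definition klists :: "'a set \<Rightarrow> nat \<Rightarrow> 'a list set" where
  "klists \<gg> k = {xs. length xs = k \<and> set xs \<subseteq> \<gg>}"

definition alt_forms :: "'a::real_vector set \<Rightarrow> nat \<Rightarrow> ('a list \<Rightarrow> real) set" where
  "alt_forms \<gg> k = {\<omega>.
     (\<forall>xs. xs \<notin> klists \<gg> k \<longrightarrow> \<omega> xs = 0) \<and>
     (\<forall>xs\<in>klists \<gg> k. \<forall>i<k. \<forall>x\<in>\<gg>. \<forall>y\<in>\<gg>. \<omega> (xs[i := x + y]) = \<omega> (xs[i := x]) + \<omega> (xs[i := y])) \<and>
     (\<forall>xs\<in>klists \<gg> k. \<forall>i<k. \<forall>c. \<forall>x\<in>\<gg>. \<omega> (xs[i := c *\<^sub>R x]) = c * \<omega> (xs[i := x])) \<and>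
     (\<forall>xs\<in>klists \<gg> k. \<forall>i<k. \<forall>j<k. i \<noteq> j \<and> xs ! i = xs ! j \<longrightarrow> \<omega> xs = 0)}"

text \<open>
  The exterior differential of a left-invariant \<open>k\<close>-form, evaluated on left-invariant vector
  fields: \<open>d\<omega>(X\<^sub>0,\<dots>,X\<^sub>k)\<close> is the sum over \<open>i < j\<close> of
  \<open>(-1)^(i+j) \<omega>([X\<^sub>i,X\<^sub>j],X\<^sub>0,\<dots>,X\<^sub>k)\<close> with \<open>X\<^sub>i\<close> and \<open>X\<^sub>j\<close> omitted from the tail. The
  terms \<open>X\<^sub>i(\<omega>(\<dots>))\<close> of the general formula are absent because these functions are constant.
  For \<open>k = 1\<close> this reads \<open>d\<omega>(X,Y) = -\<omega>([X,Y])\<close>.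
\<close>

definition ext_diff ::
  "'a set \<Rightarrow> ('a \<Rightarrow> 'a \<Rightarrow> 'a) \<Rightarrow> nat \<Rightarrow> ('a list \<Rightarrow> real) \<Rightarrow> 'a list \<Rightarrow> real" where
  "ext_diff \<gg> br k \<omega> = (\<lambda>xs. if xs \<in> klists \<gg> (Suc k)
     then \<Sum>j<Suc k. \<Sum>i<j. (-1) ^ (i + j) *
            \<omega> (br (xs ! i) (xs ! j) # nths xs (- {i, j}))
     else 0)"

definition cocycles ::
  "'a::real_vector set \<Rightarrow> ('a \<Rightarrow> 'a \<Rightarrow> 'a) \<Rightarrow> nat \<Rightarrow> ('a list \<Rightarrow> real) set" where
  "cocycles \<gg> br k = {\<omega> \<in> alt_forms \<gg> k. ext_diff \<gg> br k \<omega> = 0}"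

fun coboundaries ::
  "'a::real_vector set \<Rightarrow> ('a \<Rightarrow> 'a \<Rightarrow> 'a) \<Rightarrow> nat \<Rightarrow> ('a list \<Rightarrow> real) set" where
  "coboundaries \<gg> br 0 = {0}"
| "coboundaries \<gg> br (Suc k) = ext_diff \<gg> br k ` alt_forms \<gg> k"

definition lie_cohomology ::
  "nat \<Rightarrow> 'a::real_vector set \<Rightarrow> ('a \<Rightarrow> 'a \<Rightarrow> 'a) \<Rightarrow> ('a list \<Rightarrow> real) set rvspace" where
  "lie_cohomology k \<gg> br = quotient_rvspace (cocycles \<gg> br k) (coboundaries \<gg> br k)"


section \<open>The Lie algebra of a matrix group\<close>

text \<open>
  The tangent space at the identity, as the set of velocities at \<open>0\<close> of curves in the group;
  for a closed subgroup of the general linear group it does not matter how smooth the curves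
  are required to be away from \<open>0\<close>. The bracket of left-invariant vector fields corresponds
  to the commutator.
\<close>

definition matrix_lie_algebra :: "(real^'n^'n) set \<Rightarrow> (real^'n^'n) set" where
  "matrix_lie_algebra G = {X. \<exists>\<gamma> :: real \<Rightarrow> real^'n^'n.
     (\<forall>t. \<gamma> t \<in> G) \<and> \<gamma> 0 = mat 1 \<and> (\<gamma> has_vector_derivative X) (at 0)}"

definition commutator :: "real^'n^'n \<Rightarrow> real^'n^'n \<Rightarrow> real^'n^'n" where
  "commutator A B = A ** B - B ** A"

definition SO2 :: "(real^2^2) set" where
  "SO2 = {A. rotation_matrix A}"

definition so2 :: "(real^2^2) set" where
  "so2 = matrix_lie_algebra SO2"

definition rot_gen :: "real^2^2" where
  "rot_gen = vector [vector [0, -1], vector [1, 0]]"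

lemma rot_gen_nth [simp]:
  "rot_gen $ 1 $ 1 = 0" "rot_gen $ 1 $ 2 = -1" "rot_gen $ 2 $ 1 = 1" "rot_gen $ 2 $ 2 = 0"
  by (auto simp: rot_gen_def)

lemma mat_eq2: "(A::real^2^2) = B \<longleftrightarrow> A$1$1=B$1$1 \<and> A$1$2=B$1$2 \<and> A$2$1=B$2$1 \<and> A$2$2=B$2$2"
  by (auto simp: vec_eq_iff forall_2)

lemma SO2_iff: "A \<in> SO2 \<longleftrightarrow> A$1$1 = A$2$2 \<and> A$1$2 = - A$2$1 \<and> (A$1$1)^2 + (A$2$1)^2 = 1"
proof -
  have "rotation_matrix A \<longleftrightarrow> transpose A ** A = mat 1 \<and> det A = 1"
    by (simp add: rotation_matrix_def orthogonal_matrix)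
  also have "\<dots> \<longleftrightarrow> (A$1$1 * A$1$1 + A$2$1*A$2$1 = 1 \<and> A$1$1*A$1$2+A$2$1*A$2$2 = 0 \<and> A$1$2*A$1$2+A$2$2*A$2$2 = 1) \<and> A$1$1*A$2$2 - A$1$2*A$2$1 = 1"
    by (auto simp: mat_eq2 matrix_matrix_mult_def transpose_def mat_def sum_2 det_2 algebra_simps)
  also have "\<dots> \<longleftrightarrow> A$1$1 = A$2$2 \<and> A$1$2 = - A$2$1 \<and> (A$1$1)^2 + (A$2$1)^2 = 1" (is "?L \<longleftrightarrow> ?R")
  proof
    assume L: ?L
    have "(A$1$1 - A$2$2)^2 + (A$1$2 + A$2$1)^2 = 0"
      using L by (simp add: power2_eq_square algebra_simps)
    then show ?R using L by (simp add: sum_power2_eq_zero_iff power2_eq_square)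
  next
    assume ?R then show ?L by (auto simp: power2_eq_square algebra_simps)
  qed
  finally show ?thesis by (simp add: SO2_def)
qed

lemma has_derivative_entry:
  assumes "(g has_vector_derivative (X::real^2^2)) (at t)"
  shows "((\<lambda>t. g t $ i $ j) has_real_derivative X$i$j) (at t)"
proof -
  have "bounded_linear (\<lambda>A::real^2^2. A $ i $ j)"
    by (rule bounded_linear_compose[OF bounded_linear_vec_nth bounded_linear_vec_nth])
  from bounded_linear.has_vector_derivative[OF this assms] show ?thesis
    by (simp add: has_real_derivative_iff_has_vector_derivative)
qed

lemma so2_eq: "so2 = range (\<lambda>c. c *\<^sub>R rot_gen)"
proof (intro set_eqI iffI)
  fix X assume "X \<in> so2"
  then obtain g where g: "\<forall>t. g t \<in> SO2" "g 0 = mat 1" "(g has_vector_derivative X) (at 0)"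
    unfolding so2_def matrix_lie_algebra_def by blast
  note D = has_derivative_entry[OF g(3)]
  have a: "g t $1$1 = g t$2$2" "g t$1$2 = - g t$2$1" "(g t$1$1)^2 + (g t$2$1)^2 = 1" for t
    using g(1) SO2_iff[of "g t"] by blast+
  have 1: "X$1$1 = X$2$2" using D[of 1 1] D[of 2 2] a(1) DERIV_unique by fastforce
  have 2: "X$1$2 = - X$2$1" using D[of 1 2] DERIV_minus[OF D[of 2 1]] a(2) DERIV_unique by fastforce
  have "((\<lambda>t. (g t$1$1)^2 + (g t$2$1)^2) has_real_derivative (2 * (X$1$1*g 0$1$1) + 2*(X$2$1*g 0$2$1))) (at 0)"
    by (rule derivative_eq_intros D refl | simp)+
  moreover have "((\<lambda>t. (g t$1$1)^2 + (g t$2$1)^2) has_real_derivative 0) (at 0)"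
    by (simp add: a(3))
  ultimately have "2 * (X$1$1*g 0$1$1) + 2*(X$2$1*g 0$2$1) = 0" by (rule DERIV_unique)
  then have 3: "X$1$1 = 0" by (simp add: g(2) mat_def)
  show "X \<in> range (\<lambda>c. c *\<^sub>R rot_gen)"
    by (rule image_eqI[of _ _ "X$2$1"]) (use 1 2 3 in \<open>auto simp: mat_eq2 rot_gen_nth\<close>)
next
  fix X assume "X \<in> range (\<lambda>c. c *\<^sub>R rot_gen)"
  then obtain c where X: "X = c *\<^sub>R rot_gen" by auto
  define g where "g t = cos (c*t) *\<^sub>R mat 1 + sin (c*t) *\<^sub>R rot_gen" for t
  have "g t \<in> SO2" for t by (simp add: SO2_iff g_def mat_def rot_gen_nth)
  moreover have "g 0 = mat 1" by (simp add: g_def)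
  moreover have "(g has_vector_derivative X) (at 0)"
    unfolding g_def X
    by (rule derivative_eq_intros refl | simp)+
  ultimately show "X \<in> so2" unfolding so2_def matrix_lie_algebra_def by blast
qed

lemma so2_skew: "so2 = {X. transpose X = - X}"
proof -
  have "X \<in> range (\<lambda>c. c *\<^sub>R rot_gen) \<longleftrightarrow> transpose X = - X" for X
  proof
    assume skew: "transpose X = - X"
    have "X $ j $ i = transpose X $ i $ j" for i j
      by (simp add: transpose_def)
    then have "X $ j $ i = - X $ i $ j" for i j
      unfolding skew by (metis vector_uminus_component)
    from this[of 1 1] this[of 2 2] this[of 2 1] have "X = (X $ 2 $ 1) *\<^sub>R rot_gen"
      by (simp add: mat_eq2)
    then show "X \<in> range (\<lambda>c. c *\<^sub>R rot_gen)" by blast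
  qed (auto simp: mat_eq2 transpose_def)
  then show ?thesis by (auto simp: so2_eq)
qed

lemma commutator_so2: "x \<in> so2 \<Longrightarrow> y \<in> so2 \<Longrightarrow> commutator x y = 0"
  by (auto simp: so2_eq commutator_def mat_eq2 matrix_matrix_mult_def sum_2)

lemma subspace_so2: "subspace so2"
  unfolding so2_eq
  by (auto simp: subspace_def image_iff intro: exI[of _ 0] simp flip: scaleR_left_distrib)

lemma lie_algebra_so2: "lie_algebra so2 commutator"
  by standard (use subspace_so2 in \<open>auto simp: commutator_so2 subspace_def\<close>)

end

theory Submission
  imports Defs
begin

text \<open>
  The Lie algebra \<open>so2\<close> is a line, spanned by \<open>rot_gen\<close>, and its bracket is zero. Every term of
  the exterior differential feeds a bracket to the form, so on an abelian Lie algebra the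
  differential is zero (\<open>ext_diff_abelian\<close>): all forms are closed, only the zero form is exact, and
  the cohomology in degree \<open>k\<close> is the space of \<open>k\<close>-forms itself. A \<open>0\<close>-form is a number, its value
  at the empty list of arguments. A \<open>1\<close>-form is a linear functional, which on a line is determined
  by its value at a spanning vector, and that value is arbitrary.

  In both degrees this says that evaluation at a suitable argument list is a linear surjection from
  the closed forms to the reals whose kernel consists of the exact forms. The first isomorphism
  theorem (\<open>quotient_by_kernel_iso_real_line\<close>) then gives the two isomorphisms.
\<close>

text \<open>
  The cosets of the kernel are the level sets of the functional, so the isomorphism sends a coset
  to the level that it represents.
\<close>

lemma quotient_by_kernel_iso_real_line:
  fixes V W :: "'v::real_vector set" and \<phi> :: "'v \<Rightarrow> real"
  assumes V: "subspace V"
    and add: "\<And>u v. \<lbrakk>u \<in> V; v \<in> V\<rbrakk> \<Longrightarrow> \<phi> (u + v) = \<phi> u + \<phi> v"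
    and scale: "\<And>c v. v \<in> V \<Longrightarrow> \<phi> (c *\<^sub>R v) = c * \<phi> v"
    and surj: "\<And>r. \<exists>v\<in>V. \<phi> v = r"
    and kernel: "\<And>v. v \<in> V \<Longrightarrow> v \<in> W \<longleftrightarrow> \<phi> v = 0"
  shows "quotient_rvspace V W \<simeq> real_line"
proof -
  define level where "level r = {v \<in> V. \<phi> v = r}" for r
  have diff: "\<phi> (u - v) = \<phi> u - \<phi> v" if "u \<in> V" "v \<in> V" for u v
    using add[of "u - v" v] subspace_diff[OF V] that by simp
  have coset: "quot_rel V W `` {v} = level (\<phi> v)" if "v \<in> V" for v
    using that kernel subspace_diff[OF V] by (auto simp: quot_rel_def level_def diff)
  have nonempty: "level r \<noteq> {}" for r
    using surj[of r] by (auto simp: level_def)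
  have inj: "inj level"
  proof (rule injI)
    fix r s
    assume "level r = level s"
    moreover obtain v where "v \<in> level r"
      using nonempty[of r] by blast
    ultimately show "r = s"
      by (auto simp: level_def)
  qed
  have carrier: "V // quot_rel V W = range level"
  proof -
    have "V // quot_rel V W = level ` \<phi> ` V"
      by (auto simp: quotient_def coset)
    moreover have "\<phi> ` V = UNIV"
      using surj by (metis UNIV_eq_I imageI)
    ultimately show ?thesis by simp
  qed
  have level_add: "(\<Union>u\<in>level r. \<Union>v\<in>level s. quot_rel V W `` {u + v}) = level (r + s)" for r s
  proof -
    have "quot_rel V W `` {u + v} = level (r + s)" if "u \<in> level r" "v \<in> level s" for u v
      using that coset[of "u + v"] subspace_add[OF V] by (auto simp: level_def add)
    then show ?thesis using nonempty[of r] nonempty[of s] by simp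
  qed
  have level_scale: "(\<Union>v\<in>level r. quot_rel V W `` {c *\<^sub>R v}) = level (c * r)" for c r
  proof -
    have "quot_rel V W `` {c *\<^sub>R v} = level (c * r)" if "v \<in> level r" for v
      using that coset[of "c *\<^sub>R v"] subspace_scale[OF V] by (auto simp: level_def scale)
    then show ?thesis using nonempty[of r] by simp
  qed
  have "bij_betw (inv level) (range level) UNIV"
    using inj by (simp add: bij_betw_inv_into inj_on_imp_bij_betw)
  then show ?thesis
    unfolding rvspace_iso_def
    by (intro exI[of _ "inv level"])
      (auto simp: quotient_rvspace_def real_line_def carrier level_add level_scale inv_f_f[OF inj])
qed

lemma subspace_alt_forms: "subspace (alt_forms \<gg> k)"
  by (rule subspaceI) (simp_all add: alt_forms_def scaleR_fun_def algebra_simps)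

lemma ext_diff_0: "ext_diff \<gg> br 0 \<omega> = 0"
  by (auto simp: ext_diff_def fun_eq_iff)

text \<open>
  Each term of the differential is the value of a form at a list that starts with a bracket, here
  with the zero vector, and forms are homogeneous in their first argument.
\<close>

lemma ext_diff_abelian:
  assumes \<omega>: "\<omega> \<in> alt_forms \<gg> k"
    and abelian: "\<And>x y. \<lbrakk>x \<in> \<gg>; y \<in> \<gg>\<rbrakk> \<Longrightarrow> br x y = 0"
  shows "ext_diff \<gg> br k \<omega> = 0"
proof -
  have zero: "\<omega> (0 # ys) = 0" for ys
  proof (cases "0 # ys \<in> klists \<gg> k")
    case True
    then have "0 < k" "0 \<in> \<gg>" by (auto simp: klists_def)
    then have "\<omega> ((0 # ys)[0 := 0 *\<^sub>R 0]) = 0 * \<omega> ((0 # ys)[0 := 0])"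
      using \<omega> True unfolding alt_forms_def by blast
    then show ?thesis by simp
  next
    case False
    then show ?thesis using \<omega> by (simp add: alt_forms_def)
  qed
  have bracket: "br (xs ! i) (xs ! j) = 0"
    if "xs \<in> klists \<gg> (Suc k)" "j < Suc k" "i < j" for xs i j
    using that by (intro abelian) (auto simp: klists_def subset_iff)
  show ?thesis
    by (auto simp: ext_diff_def fun_eq_iff zero bracket intro!: sum.neutral)
qed

lemma cohomology_0_iso_real_line: "lie_cohomology 0 \<gg> br \<simeq> real_line"
proof -
  have cocycles: "cocycles \<gg> br 0 = alt_forms \<gg> 0"
    by (simp add: cocycles_def ext_diff_0)
  have surj: "\<exists>\<omega>\<in>alt_forms \<gg> 0. \<omega> [] = r" for r
    by (rule bexI[of _ "\<lambda>xs. if xs = [] then r else 0"]) (auto simp: alt_forms_def klists_def)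
  have kernel: "\<omega> \<in> {0} \<longleftrightarrow> \<omega> [] = 0" if "\<omega> \<in> alt_forms \<gg> 0" for \<omega>
    using that by (auto simp: alt_forms_def klists_def fun_eq_iff) metis
  show ?thesis
    unfolding lie_cohomology_def cocycles coboundaries.simps
    by (rule quotient_by_kernel_iso_real_line[where \<phi> = "\<lambda>\<omega>. \<omega> []", OF subspace_alt_forms])
      (use surj kernel in \<open>auto simp: scaleR_fun_def\<close>)
qed

text \<open>
  The bracket of a one-dimensional Lie algebra is alternating, hence zero; so this covers all of
  them.
\<close>

lemma cohomology_1_line_iso_real_line:
  fixes e :: "'a::real_vector"
  assumes "e \<noteq> 0"
    and abelian: "\<And>x y. \<lbrakk>x \<in> span {e}; y \<in> span {e}\<rbrakk> \<Longrightarrow> br x y = 0"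
  shows "lie_cohomology 1 (span {e}) br \<simeq> real_line"
proof -
  let ?g = "span {e}"
  have cocycles: "cocycles ?g br 1 = alt_forms ?g 1"
    using ext_diff_abelian[where br = br, OF _ abelian] by (auto simp: cocycles_def)
  have "0 \<in> alt_forms ?g 0"
    by (rule subspace_0[OF subspace_alt_forms])
  then have coboundaries: "coboundaries ?g br 1 = {0}"
    by (auto simp: ext_diff_0)
  have surj: "\<exists>\<omega>\<in>alt_forms ?g 1. \<omega> [e] = r" for r
  proof -
    have "independent {e}"
      using \<open>e \<noteq> 0\<close> by simp
    then obtain h :: "'a \<Rightarrow> real" where h: "linear h" "h e = r"
      using linear_independent_extend[of "{e}" "\<lambda>_. r"] by auto
    define \<omega> where "\<omega> xs = (if xs \<in> klists ?g 1 then h (hd xs) else 0)" for xs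
    have "\<omega> \<in> alt_forms ?g 1"
      using h(1)
      by (auto simp: alt_forms_def \<omega>_def klists_def length_Suc_conv span_add span_scale
          linear_add linear_scale)
    moreover have "\<omega> [e] = r"
      by (simp add: \<omega>_def klists_def h(2) span_base)
    ultimately show ?thesis by blast
  qed
  have kernel: "\<omega> \<in> {0} \<longleftrightarrow> \<omega> [e] = 0" if \<omega>: "\<omega> \<in> alt_forms ?g 1" for \<omega>
  proof
    assume "\<omega> [e] = 0"
    have "\<omega> xs = 0" for xs
    proof (cases "xs \<in> klists ?g 1")
      case True
      then have "\<exists>c. xs = [c *\<^sub>R e]"
        by (auto simp: klists_def length_Suc_conv span_singleton)
      then obtain c where xs: "xs = [c *\<^sub>R e]" ..
      have "e \<in> ?g" "[e] \<in> klists ?g 1"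
        by (simp_all add: klists_def span_base)
      then have "\<omega> ([e][0 := c *\<^sub>R e]) = c * \<omega> ([e][0 := e])"
        using \<omega> unfolding alt_forms_def by blast
      then show ?thesis using \<open>\<omega> [e] = 0\<close> by (simp add: xs)
    next
      case False
      then show ?thesis using \<omega> by (simp add: alt_forms_def)
    qed
    then show "\<omega> \<in> {0}" by (simp add: fun_eq_iff)
  qed simp
  show ?thesis
    unfolding lie_cohomology_def cocycles coboundaries
    by (rule quotient_by_kernel_iso_real_line[where \<phi> = "\<lambda>\<omega>. \<omega> [e]", OF subspace_alt_forms])
      (use surj kernel in \<open>auto simp: scaleR_fun_def\<close>)
qed

theorem theorem24:
  shows "lie_cohomology 0 so2 commutator \<simeq> real_line \<and>
         lie_cohomology 1 so2 commutator \<simeq> real_line"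
proof
  show "lie_cohomology 0 so2 commutator \<simeq> real_line"
    by (rule cohomology_0_iso_real_line)
  have line: "so2 = span {rot_gen}"
    by (simp add: so2_eq span_singleton)
  have "rot_gen \<noteq> 0"
    by (simp add: mat_eq2)
  then show "lie_cohomology 1 so2 commutator \<simeq> real_line"
    unfolding line
    by (rule cohomology_1_line_iso_real_line) (simp add: commutator_so2 line)
qed

end
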